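(* Let $G=(V,E)$ be a finite simple graph with minimum vertex degree $\geq 2$, let $\mathcal{L}$ be its non-backtracking Laplacian, let $d>2$ be an integer and let $\ell\ge 3$. If there exists a simple chordless cycle of length $\ell$ in $G$ such that one of its vertices has degree $d$ in $G$ while all its other vertices have degree $2$ in $G$, then $1-\frac{1}{\sqrt[\ell]{d-1}}$ is an eigenvalue of $\mathcal{L}$. If, additionally, such a cycle is even (that is, $\ell$ is even), then $1+\frac{1}{\sqrt[\ell]{d-1}}$ is also an eigenvalue of $\mathcal{L}$. Moreover, the geometric multiplicity of $1-\frac{1}{\sqrt[\ell]{d-1}}$ for $\mathcal{L}$ is larger than or equal to the number of such cycles in $G$ (simple chordless cycles of length $\ell$ with one vertex of degree $d$ and all other vertices of degree $2$), while, the geometric multiplicity of $1+\frac{1}{\sqrt[\ell]{d-1}}$ for $\mathcal{L}$ is larger than or equal to the number of such even cycles in $G$.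
   Context: Let $G=(V,E)$ be a finite simple undirected graph with minimum degree $\ge 2$. An oriented edge of $G$ is an ordered pair $e=[v,w]$ of adjacent vertices, with input $v$ and output $w$; if $G$ has $M$ edges it has $2M$ oriented edges. The non-backtracking graph $\mathcal{NB}(G)$ is the directed graph whose vertices are the $2M$ oriented edges of $G$, with a directed edge $e\to e'$ if and only if the output of $e$ equals the input of $e'$ and the input of $e$ differs from the output of $e'$. Each vertex $e=[v,w]$ of $\mathcal{NB}(G)$ has outdegree $\deg_G w-1\ge 1$. Let $\mathcal{A}$ be the adjacency matrix of $\mathcal{NB}(G)$ ($\mathcal{A}_{e,e'}=1$ if $e\to e'$, and $0$ otherwise) and $\mathcal{D}$ the diagonal matrix of outdegrees. The non-backtracking Laplacian of $G$ is $\mathcal{L}=\mathrm{Id}-\mathcal{D}^{-1}\mathcal{A}$, acting on functions on oriented edges by $\mathcal{L}f([v,w])=f([v,w])-\frac{1}{\deg_G w-1}\sum_{z\sim w,\,z\ne v}f([w,z])$. A simple chordless cycle $\{c_1,\ldots,c_\ell\}$ of length $\ell\ge 3$ in $G$ consists of distinct vertices with $c_i\sim c_{i+1}$ (indices modulo $\ell$) and no other edges of $G$ among them; cycles are counted as subgraphs (irrespective of starting point and direction). *)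

theory Defs
  imports
    Complex_Main
    "HOL-Library.Function_Algebras"
    "Graph_Theory.Graph_Theory"
begin

text \<open>
  A finite simple undirected graph is a \<open>pair_graph\<close>: a finite symmetric loopfree set
  \<open>parcs G\<close> of ordered pairs of vertices. An oriented edge \<open>[v, w]\<close> is thus an element
  \<open>(v, w)\<close> of \<open>parcs G\<close>, with input \<open>v\<close> and output \<open>w\<close>, each undirected edge contributes
  two of them, and the degree of \<open>v\<close> in the undirected graph is its out-degree.
\<close>

abbreviation deg :: "'a pair_pre_digraph \<Rightarrow> 'a \<Rightarrow> nat" where
  "deg G v \<equiv> out_degree (with_proj G) v"

definition nb_graph :: "'a pair_pre_digraph \<Rightarrow> ('a \<times> 'a) pair_pre_digraph" where
  "nb_graph G = \<lparr> pverts = parcs G,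
     parcs = {(e, e'). e \<in> parcs G \<and> e' \<in> parcs G \<and> snd e = fst e' \<and> fst e \<noteq> snd e'} \<rparr>"

definition nb_adjacency :: "'a pair_pre_digraph \<Rightarrow> 'a \<times> 'a \<Rightarrow> 'a \<times> 'a \<Rightarrow> complex" where
  "nb_adjacency G e e' = (if (e, e') \<in> parcs (nb_graph G) then 1 else 0)"

text \<open>
  The matrix \<open>Id - D\<^sup>-\<^sup>1 A\<close>; since \<open>D\<close> is diagonal, multiplying by its inverse from the left
  divides row \<open>e\<close> by the out-degree of \<open>e\<close> in the non-backtracking graph.
\<close>

definition nb_laplacian_matrix :: "'a pair_pre_digraph \<Rightarrow> 'a \<times> 'a \<Rightarrow> 'a \<times> 'a \<Rightarrow> complex" where
  "nb_laplacian_matrix G e e' =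
     (if e = e' then 1 else 0) - nb_adjacency G e e' / of_nat (out_degree (with_proj (nb_graph G)) e)"

text \<open>
  A function on oriented edges is represented by its extension by zero to all pairs,
  so that the functions on oriented edges form a subspace of \<open>'a \<times> 'a \<Rightarrow> complex\<close>.
\<close>

definition edge_functions :: "'a pair_pre_digraph \<Rightarrow> ('a \<times> 'a \<Rightarrow> complex) set" where
  "edge_functions G = {f. \<forall>e. e \<notin> parcs G \<longrightarrow> f e = 0}"

definition nb_laplacian ::
    "'a pair_pre_digraph \<Rightarrow> ('a \<times> 'a \<Rightarrow> complex) \<Rightarrow> 'a \<times> 'a \<Rightarrow> complex" where
  "nb_laplacian G f e =
     (if e \<in> parcs G then \<Sum>e'\<in>parcs G. nb_laplacian_matrix G e e' * f e' else 0)"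

definition nb_eigenspace :: "'a pair_pre_digraph \<Rightarrow> complex \<Rightarrow> ('a \<times> 'a \<Rightarrow> complex) set" where
  "nb_eigenspace G \<mu> = {f \<in> edge_functions G. nb_laplacian G f = (\<lambda>e. \<mu> * f e)}"

definition nb_eigenvalue :: "'a pair_pre_digraph \<Rightarrow> complex \<Rightarrow> bool" where
  "nb_eigenvalue G \<mu> \<longleftrightarrow> (\<exists>f \<in> nb_eigenspace G \<mu>. f \<noteq> 0)"

definition nb_geometric_multiplicity :: "'a pair_pre_digraph \<Rightarrow> complex \<Rightarrow> nat" where
  "nb_geometric_multiplicity G \<mu> = vector_space.dim (\<lambda>c f e. c * f e) (nb_eigenspace G \<mu>)"

text \<open>
  Cycles are subgraphs \<open>H\<close>, so that the enumeration \<open>c\<close> (starting point and direction) is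
  irrelevant when they are counted. The last condition says that \<open>H\<close> is a subgraph of \<open>G\<close>
  and has no chords in \<open>G\<close>.
\<close>

definition chordless_cycle :: "'a pair_pre_digraph \<Rightarrow> nat \<Rightarrow> 'a pair_pre_digraph \<Rightarrow> bool" where
  "chordless_cycle G l H \<longleftrightarrow> l \<ge> 3 \<and>
     (\<exists>c :: nat \<Rightarrow> 'a. inj_on c {..<l} \<and> pverts H = c ` {..<l} \<and>
        parcs H = {(c i, c j) | i j. i < l \<and> j < l \<and> (j = Suc i mod l \<or> i = Suc j mod l)}) \<and>
     pverts H \<subseteq> pverts G \<and> parcs H = parcs G \<inter> (pverts H \<times> pverts H)"

definition pendant_cycle ::
    "'a pair_pre_digraph \<Rightarrow> nat \<Rightarrow> nat \<Rightarrow> 'a pair_pre_digraph \<Rightarrow> bool" where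
  "pendant_cycle G d l H \<longleftrightarrow> chordless_cycle G l H \<and>
     (\<exists>v \<in> pverts H. deg G v = d \<and> (\<forall>u \<in> pverts H - {v}. deg G u = 2))"

lemma vector_space_pair_functions:
  "vector_space (\<lambda>(c :: complex) (f :: 'a \<times> 'a \<Rightarrow> complex) e. c * f e)"
  by unfold_locales (auto simp: fun_eq_iff algebra_simps)

lemma subspace_nb_eigenspace:
  "module.subspace (\<lambda>c f e. c * f e) (nb_eigenspace G \<mu>)"
proof -
  interpret vector_space "\<lambda>(c :: complex) (f :: 'a \<times> 'a \<Rightarrow> complex) e. c * f e"
    by (rule vector_space_pair_functions)
  have add: "nb_laplacian G (f + g) = nb_laplacian G f + nb_laplacian G g" for f g
    by (rule ext) (simp add: nb_laplacian_def distrib_left sum.distrib)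
  have scale: "nb_laplacian G (\<lambda>e. c * f e) = (\<lambda>e. c * nb_laplacian G f e)" for c f
    by (rule ext) (simp add: nb_laplacian_def sum_distrib_left mult.left_commute)
  show ?thesis
  proof (rule subspaceI)
    show "0 \<in> nb_eigenspace G \<mu>"
      by (simp add: nb_eigenspace_def edge_functions_def nb_laplacian_def fun_eq_iff)
    show "f + g \<in> nb_eigenspace G \<mu>"
      if "f \<in> nb_eigenspace G \<mu>" "g \<in> nb_eigenspace G \<mu>" for f g
      using that by (simp add: nb_eigenspace_def edge_functions_def add fun_eq_iff distrib_left)
    show "(\<lambda>e. c * f e) \<in> nb_eigenspace G \<mu>" if "f \<in> nb_eigenspace G \<mu>" for c f
      using that by (simp add: nb_eigenspace_def edge_functions_def scale mult.left_commute)
  qed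
qed

lemma out_degree_nb_graph:
  assumes "pair_graph G" "(v, w) \<in> parcs G"
  shows "out_degree (with_proj (nb_graph G)) (v, w) = deg G w - 1"
proof -
  interpret pair_graph G by fact
  have "out_arcs (with_proj (nb_graph G)) (v, w) = Pair (v, w) ` (out_arcs (with_proj G) w - {(w, v)})"
    using assms(2) by (auto simp: out_arcs_def nb_graph_def)
  moreover have "(w, v) \<in> out_arcs (with_proj G) w"
    using arcs_symmetric[OF assms(2)] by simp
  ultimately show ?thesis
    by (simp add: out_degree_def card_image inj_on_def)
qed

lemma nb_laplacian_eq:
  assumes "pair_graph G" "(v, w) \<in> parcs G"
  shows "nb_laplacian G f (v, w) =
    f (v, w) - (\<Sum>z | (w, z) \<in> parcs G \<and> z \<noteq> v. f (w, z)) / of_nat (deg G w - 1)"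
proof -
  interpret pair_graph G by fact
  let ?n = "of_nat (deg G w - 1) :: complex"
  have entry: "nb_laplacian_matrix G (v, w) e' * f e' =
      (if e' = (v, w) then f e' else 0) - (if w = fst e' \<and> v \<noteq> snd e' then f e' / ?n else 0)"
    if "e' \<in> parcs G" for e'
  proof -
    have "nb_adjacency G (v, w) e' = (if w = fst e' \<and> v \<noteq> snd e' then 1 else 0)"
      using that assms(2) by (auto simp: nb_adjacency_def nb_graph_def)
    moreover have "((if P then 1 else 0) - (if Q then 1 else 0) / n) * x =
        (if P then x else 0) - (if Q then x / n else 0)" for P Q and n x :: complex
      by (cases P; cases Q; simp add: left_diff_distrib)
    ultimately show ?thesis
      by (simp only: nb_laplacian_matrix_def out_degree_nb_graph[OF assms] eq_commute[of "(v, w)" e'])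
  qed
  have "nb_laplacian G f (v, w) =
      (\<Sum>e'\<in>parcs G. (if e' = (v, w) then f e' else 0)
        - (if w = fst e' \<and> v \<noteq> snd e' then f e' / ?n else 0))"
    unfolding nb_laplacian_def using assms(2) by (simp only: if_True entry cong: sum.cong)
  also have "\<dots> = f (v, w) - (\<Sum>e' \<in> {e' \<in> parcs G. w = fst e' \<and> v \<noteq> snd e'}. f e' / ?n)"
    using assms(2) by (simp only: sum_subtractf sum.inter_filter[OF pair_finite_arcs]
        sum.delta[OF pair_finite_arcs] if_True)
  also have "(\<Sum>e' \<in> {e' \<in> parcs G. w = fst e' \<and> v \<noteq> snd e'}. f e' / ?n) =
      (\<Sum>z | (w, z) \<in> parcs G \<and> z \<noteq> v. f (w, z) / ?n)"
    by (rule sum.reindex_bij_witness[of _ "Pair w" snd]) auto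
  finally show ?thesis by (simp add: sum_divide_distrib)
qed

lemma finite_pendant_cycles:
  assumes "pair_graph G"
  shows "finite {H. pendant_cycle G d l H}"
proof -
  interpret pair_graph G by fact
  have "{H. pendant_cycle G d l H} \<subseteq>
      (\<lambda>(V, E). \<lparr> pverts = V, parcs = E \<rparr>) ` (Pow (pverts G) \<times> Pow (parcs G))"
  proof
    fix H assume "H \<in> {H. pendant_cycle G d l H}"
    then have "pverts H \<subseteq> pverts G" "parcs H \<subseteq> parcs G"
      by (auto simp: pendant_cycle_def chordless_cycle_def)
    then show "H \<in> (\<lambda>(V, E). \<lparr> pverts = V, parcs = E \<rparr>) ` (Pow (pverts G) \<times> Pow (parcs G))"
      by (intro image_eqI[of _ _ "(pverts H, parcs H)"]) auto
  qed
  then show ?thesis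
    using pair_finite_verts pair_finite_arcs by (auto intro: finite_subset)
qed

end

theory Submission
  imports Defs "HOL-Number_Theory.Cong"
begin

text \<open>
  Write \<open>1 - \<mu> = \<zeta>\<close>, so that \<open>\<zeta>\<^sup>l (d - 1) = 1\<close>. Around a cycle whose vertices other than \<open>c 0\<close> have
  degree 2, the eigenvalue equation propagates a value given on the first arc to \<open>1, \<zeta>, \<zeta>\<^sup>2, \<dots>\<close>.
  The wave sent from \<open>c 0\<close> in one direction minus the wave sent in the other direction solves the
  equation also at \<open>c 0\<close>: on arcs entering from outside the cycle the two contributions cancel, and
  on the last arc of each wave the equation is \<open>\<zeta> (d - 1) \<zeta>\<^bsup>l-1\<^esup> = 1\<close>. Two different such cycles share
  no vertex of degree 2, so an arc of one cycle is never in the support for another one, which makes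
  these eigenfunctions linearly independent.
\<close>

section \<open>The eigenvalue equation on arcs, and a lower bound for the multiplicity\<close>

lemma deg_eq_card: "deg G v = card {w. (v, w) \<in> parcs G}"
proof -
  have "out_arcs (with_proj G) v = Pair v ` {w. (v, w) \<in> parcs G}"
    by (auto simp: out_arcs_def)
  then show ?thesis
    by (simp add: out_degree_def card_image inj_on_def)
qed

text \<open>The eigenvalue equation with its denominator cleared: minimum degree 2 makes
  \<open>deg G w - 1\<close> nonzero, and off the arcs both sides vanish.\<close>

lemma mem_nb_eigenspaceI:
  assumes G: "pair_graph G" and deg: "\<forall>v \<in> pverts G. deg G v \<ge> 2"
    and f: "f \<in> edge_functions G"
    and eq: "\<And>v w. (v, w) \<in> parcs G \<Longrightarrow>
      (\<Sum>z | (w, z) \<in> parcs G \<and> z \<noteq> v. f (w, z)) = \<zeta> * of_nat (deg G w - 1) * f (v, w)"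
  shows "f \<in> nb_eigenspace G (1 - \<zeta>)"
proof -
  interpret pair_graph G by fact
  have "nb_laplacian G f (v, w) = (1 - \<zeta>) * f (v, w)" for v w
  proof (cases "(v, w) \<in> parcs G")
    case True
    then have "w \<in> pverts G" by (auto dest: in_arcsD2)
    then have "of_nat (deg G w - 1) \<noteq> (0 :: complex)"
      using deg by (simp only: of_nat_eq_0_iff) fastforce
    then show ?thesis
      using nb_laplacian_eq[OF G True, of f] eq[OF True] by (simp add: left_diff_distrib)
  next
    case False
    then show ?thesis using f by (simp add: nb_laplacian_def edge_functions_def)
  qed
  then show ?thesis using f by (auto simp: nb_eigenspace_def)
qed

text \<open>The functions vanishing at \<open>e i\<close> form a subspace that contains every
  \<open>f j\<close> with \<open>j \<noteq> i\<close> but not \<open>f i\<close>, so the family is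
  independent. It extends to a basis \<open>B\<close> of the eigenspace.\<close>

lemma card_le_nb_geometric_multiplicity:
  fixes f :: "'i \<Rightarrow> 'a \<times> 'a \<Rightarrow> complex"
  assumes G: "pair_graph G"
    and mem: "\<And>i. i \<in> I \<Longrightarrow> f i \<in> nb_eigenspace G \<mu>"
    and diag: "\<And>i. i \<in> I \<Longrightarrow> f i (e i) \<noteq> 0"
    and off: "\<And>i j. i \<in> I \<Longrightarrow> j \<in> I \<Longrightarrow> i \<noteq> j \<Longrightarrow> f j (e i) = 0"
  shows "card I \<le> nb_geometric_multiplicity G \<mu>"
proof -
  interpret pair_graph G by fact
  interpret vector_space "\<lambda>(c :: complex) (f :: 'a \<times> 'a \<Rightarrow> complex) e. c * f e"
    by (rule vector_space_pair_functions)
  let ?V = "nb_eigenspace G \<mu>"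
  have inj: "inj_on f I"
    by (rule inj_onI) (metis diag off)
  have indep: "independent (f ` I)"
    unfolding dependent_def
  proof clarify
    fix i assume i: "i \<in> I" and "f i \<in> span (f ` I - {f i})"
    moreover have "span (f ` I - {f i}) \<subseteq> {g. g (e i) = 0}"
      by (rule span_minimal) (use off[OF i] in \<open>auto simp: subspace_def\<close>)
    ultimately show False using diag[OF i] by auto
  qed
  have "f ` I \<subseteq> ?V" using mem by auto
  then obtain B where B: "f ` I \<subseteq> B" "B \<subseteq> ?V" "independent B" "?V \<subseteq> span B"
    using indep by (rule maximal_independent_subset_extend)
  \<comment> \<open>The indicators of the finitely many arcs span the eigenspace, so
    \<open>B\<close> is finite; without finiteness \<open>card B\<close> could be the default value
    0.\<close>
  define \<delta> where "\<delta> a = (\<lambda>b. if b = a then 1 else 0 :: complex)" for a :: "'a \<times> 'a"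
  have "g \<in> span (\<delta> ` parcs G)" if "g \<in> ?V" for g
  proof -
    have expand: "g b = (\<Sum>a\<in>parcs G. g a * \<delta> a b)" for b
    proof (cases "b \<in> parcs G")
      case True
      then show ?thesis
        using pair_finite_arcs by (simp add: \<delta>_def if_distrib cong: if_cong)
    next
      case False
      then have "g b = 0"
        using that unfolding nb_eigenspace_def edge_functions_def by blast
      also have "0 = (\<Sum>a\<in>parcs G. g a * \<delta> a b)"
        using False by (intro sum.neutral[symmetric]) (auto simp: \<delta>_def)
      finally show ?thesis .
    qed
    have apply_sum: "(\<Sum>a\<in>parcs G. (\<lambda>b. g a * \<delta> a b)) b = (\<Sum>a\<in>parcs G. g a * \<delta> a b)" for b
      using pair_finite_arcs by (induction rule: finite_induct) auto
    have eq: "g = (\<Sum>a\<in>parcs G. (\<lambda>b. g a * \<delta> a b))"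
      by (rule ext) (rule trans[OF expand apply_sum[symmetric]])
    show ?thesis
    proof (subst eq, rule span_sum)
      fix a assume "a \<in> parcs G"
      then have "\<delta> a \<in> span (\<delta> ` parcs G)" by (intro span_base imageI)
      then show "(\<lambda>b. g a * \<delta> a b) \<in> span (\<delta> ` parcs G)" by (rule span_scale)
    qed
  qed
  then have "B \<subseteq> span (\<delta> ` parcs G)" using B(2) by auto
  then have "finite B"
    using independent_span_bound[of "\<delta> ` parcs G" B] B(3) pair_finite_arcs by auto
  have "card I = card (f ` I)" using inj by (simp add: card_image)
  also have "\<dots> \<le> card B" using \<open>finite B\<close> B(1) by (rule card_mono)
  also have "\<dots> = dim ?V" using basis_card_eq_dim B(2-4) by auto
  finally show ?thesis by (simp add: nb_geometric_multiplicity_def)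
qed

section \<open>Enumerations of a pendant cycle starting at its vertex of degree
  \<open>d\<close>\<close>

locale cycle_enum =
  fixes G :: "'a pair_pre_digraph" and d l :: nat and c :: "nat \<Rightarrow> 'a"
  assumes graph: "pair_graph G" and d_gt: "d > 2" and l_ge: "l \<ge> 3"
    and inj: "inj_on c {..<l}" and closed: "c l = c 0"
    and arc: "i < l \<Longrightarrow> (c i, c (Suc i)) \<in> parcs G"
    and deg_0: "deg G (c 0) = d"
    and deg_2: "0 < i \<Longrightarrow> i < l \<Longrightarrow> deg G (c i) = 2"
begin

sublocale pair_graph G by (rule graph)

lemma c_eq_iff: "i < l \<Longrightarrow> j < l \<Longrightarrow> c i = c j \<longleftrightarrow> i = j"
  using inj by (auto dest: inj_onD)

text \<open>The convention \<open>c l = c 0\<close> replaces indices modulo \<open>l\<close>; only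
  the wrap-around \<open>Suc i = l\<close> needs separate treatment.\<close>

lemma c_Suc_eq_iff: "i < l \<Longrightarrow> j < l \<Longrightarrow> c (Suc i) = c (Suc j) \<longleftrightarrow> i = j"
  using c_eq_iff[of "Suc i" "Suc j"] c_eq_iff[of "Suc i" 0] c_eq_iff[of 0 "Suc j"] closed
  by (cases "Suc i = l"; cases "Suc j = l") auto

lemma c_mem: "i \<le> l \<Longrightarrow> c i \<in> c ` {..<l}"
  using closed l_ge by (cases "i = l") auto

text \<open>Traversal in the opposite direction keeps the starting point \<open>c 0\<close>, so
  every fact about a wave also holds for the wave running the other way.\<close>

lemma reverse: "cycle_enum G d l (\<lambda>i. c (l - i))"
proof
  show "inj_on (\<lambda>i. c (l - i)) {..<l}"
  proof (rule inj_onI)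
    fix i j assume ij: "i \<in> {..<l}" "j \<in> {..<l}" "c (l - i) = c (l - j)"
    \<comment> \<open>Since \<open>l - i\<close> ranges over 1 to \<open>l\<close>, it is written as
      a successor to land in the range of \<open>c_Suc_eq_iff\<close>.\<close>
    then have "l - Suc i = l - Suc j"
      by (subst c_Suc_eq_iff[symmetric]) (auto simp: Suc_diff_Suc)
    then show "i = j" using ij by auto
  qed
  show "(c (l - i), c (l - Suc i)) \<in> parcs G" if "i < l" for i
    using arcs_symmetric[OF arc[of "l - Suc i"]] that by (simp add: Suc_diff_Suc)
qed (use d_gt l_ge closed deg_0 deg_2 in auto)

text \<open>This is where \<open>l \<ge> 3\<close> enters: a cycle of length 2 would return to
  \<open>c i\<close> after two steps.\<close>

lemma c_neq_Suc_Suc: "Suc i < l \<Longrightarrow> c i \<noteq> c (Suc (Suc i))"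
  using c_eq_iff[of i "Suc (Suc i)"] c_eq_iff[of i 0] closed l_ge
  by (cases "Suc (Suc i) = l") auto

lemma neighbours:
  assumes "Suc i < l"
  shows "{z. (c (Suc i), z) \<in> parcs G} = {c i, c (Suc (Suc i))}"
proof -
  have "card {z. (c (Suc i), z) \<in> parcs G} = 2"
    using deg_2[of "Suc i"] assms by (simp add: deg_eq_card)
  moreover have "{c i, c (Suc (Suc i))} \<subseteq> {z. (c (Suc i), z) \<in> parcs G}"
    using arcs_symmetric[OF arc[of i]] arc[of "Suc i"] assms by simp
  moreover have "card {c i, c (Suc (Suc i))} = 2"
    using c_neq_Suc_Suc[OF assms] by simp
  ultimately show ?thesis
    by (metis card.infinite card_subset_eq zero_neq_numeral)
qed

text \<open>A vertex of degree 2 on \<open>c'\<close> is not \<open>c' 0\<close>, because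
  \<open>d > 2\<close>, so both its neighbours lie on \<open>c'\<close>. Walking along
  \<open>c\<close> from \<open>c 1\<close> therefore never leaves \<open>c'\<close> before closing
  up at \<open>c 0\<close>; equal cardinalities finish.\<close>

lemma vertices_eq:
  assumes "cycle_enum G d l c'" and "c 1 \<in> c' ` {..<l}"
  shows "c ` {..<l} = c' ` {..<l}"
proof -
  interpret c': cycle_enum G d l c' by fact
  have step: "z \<in> c' ` {..<l}"
    if y: "y \<in> c' ` {..<l}" and "deg G y = 2" and z: "(y, z) \<in> parcs G" for y z
  proof -
    from y obtain i where i: "i < l" "y = c' i" by auto
    with that d_gt c'.deg_0 obtain k where k: "i = Suc k" by (cases i) auto
    have "z \<in> {c' k, c' (Suc (Suc k))}"
      using c'.neighbours[of k] i z unfolding k by auto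
    then show ?thesis using i k c'.c_mem[of k] c'.c_mem[of "Suc (Suc k)"] by auto
  qed
  have up: "c (Suc i) \<in> c' ` {..<l}" if "i < l" for i
    using that
  proof (induction i)
    case 0
    then show ?case using assms by simp
  next
    case (Suc i)
    then show ?case using step[of "c (Suc i)"] deg_2[of "Suc i"] arc[of "Suc i"] by simp
  qed
  \<comment> \<open>The vertex \<open>c 0\<close> is reached last, as \<open>c l\<close>.\<close>
  have "c i \<in> c' ` {..<l}" if "i < l" for i
    using that up[of "i - 1"] up[of "l - 1"] closed l_ge by (cases i) auto
  then have "c ` {..<l} \<subseteq> c' ` {..<l}" by auto
  moreover have "card (c ` {..<l}) = card (c' ` {..<l})"
    using inj c'.inj by (simp add: card_image)
  ultimately show ?thesis by (intro card_subset_eq) auto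
qed

section \<open>Geometric waves along the cycle\<close>

definition wave :: "complex \<Rightarrow> 'a \<times> 'a \<Rightarrow> complex" where
  "wave \<zeta> e = (\<Sum>i<l. if e = (c i, c (Suc i)) then \<zeta> ^ i else 0)"

text \<open>The vertices are distinct, so the input of an arc selects at most one summand of the
  wave.\<close>

lemma wave_from:
  assumes "i < l"
  shows "wave \<zeta> (c i, z) = (if z = c (Suc i) then \<zeta> ^ i else 0)"
proof -
  have "wave \<zeta> (c i, z) = (\<Sum>j<l. if j = i then if z = c (Suc i) then \<zeta> ^ i else 0 else 0)"
    unfolding wave_def using assms by (intro sum.cong) (auto simp: c_eq_iff)
  then show ?thesis using assms by simp
qed

lemma wave_to:
  assumes "i < l"
  shows "wave \<zeta> (x, c (Suc i)) = (if x = c i then \<zeta> ^ i else 0)"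
proof -
  have "wave \<zeta> (x, c (Suc i)) = (\<Sum>j<l. if j = i then if x = c i then \<zeta> ^ i else 0 else 0)"
    unfolding wave_def using assms by (intro sum.cong) (auto simp: c_Suc_eq_iff)
  then show ?thesis using assms by simp
qed

lemma wave_support:
  assumes "wave \<zeta> (x, y) \<noteq> 0"
  shows "(x, y) \<in> parcs G" "x \<in> c ` {..<l}" "y \<in> c ` {..<l}"
proof -
  obtain i where "i < l" "(x, y) = (c i, c (Suc i))"
    using assms unfolding wave_def
    by (elim sum.not_neutral_contains_not_neutral) (auto split: if_splits)
  then show "(x, y) \<in> parcs G" "x \<in> c ` {..<l}" "y \<in> c ` {..<l}"
    using arc c_mem[of i] c_mem[of "Suc i"] by auto
qed

text \<open>At a cycle vertex of degree 2 there is exactly one non-backtracking continuation: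
  forwards it multiplies the value by \<open>\<zeta>\<close>, backwards both sides are 0. Off the
  cycle everything vanishes.\<close>

lemma wave_propagates:
  assumes "(x, y) \<in> parcs G" and "y \<noteq> c 0"
  shows "(\<Sum>z | (y, z) \<in> parcs G \<and> z \<noteq> x. wave \<zeta> (y, z)) =
    \<zeta> * of_nat (deg G y - 1) * wave \<zeta> (x, y)"
proof (cases "y \<in> c ` {..<l}")
  case True
  then obtain i where i: "Suc i < l" "y = c (Suc i)"
    using \<open>y \<noteq> c 0\<close> by (metis imageE lessThan_iff not0_implies_Suc)
  note nb = neighbours[OF i(1)]
  have ne: "c i \<noteq> c (Suc (Suc i))" using c_neq_Suc_Suc[OF i(1)] .
  have "x \<in> {c i, c (Suc (Suc i))}"
    using arcs_symmetric[OF assms(1)] nb i by auto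
  then consider "x = c i" | "x = c (Suc (Suc i))" by auto
  then show ?thesis
  proof cases
    case 1
    then have "{z. (y, z) \<in> parcs G \<and> z \<noteq> x} = {c (Suc (Suc i))}"
      using nb i ne by auto
    then show ?thesis using 1 i deg_2[of "Suc i"] by (simp add: wave_from)
  next
    case 2
    then have "{z. (y, z) \<in> parcs G \<and> z \<noteq> x} = {c i}"
      using nb i ne by auto
    then show ?thesis using 2 i ne by (simp add: wave_from wave_to)
  qed
next
  case False
  then have "wave \<zeta> (y, z) = 0" "wave \<zeta> (z, y) = 0" for z
    using wave_support by blast+
  then show ?thesis by simp
qed

text \<open>Among the arcs leaving \<open>c 0\<close> only the one to \<open>c 1\<close> carries the
  wave, with value 1; it is excluded exactly when it would backtrack.\<close>

lemma wave_start:
  "(\<Sum>z | (c 0, z) \<in> parcs G \<and> z \<noteq> x. wave \<zeta> (c 0, z)) = (if x = c 1 then 0 else 1)"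
proof -
  have "finite {z. (c 0, z) \<in> parcs G \<and> z \<noteq> x}"
    by (rule finite_subset[OF _ pair_finite_verts]) (auto dest: in_arcsD2)
  moreover have "(c 0, c 1) \<in> parcs G" using arc[of 0] l_ge by simp
  ultimately show ?thesis using l_ge by (auto simp: wave_from)
qed

lemma wave_end: "wave \<zeta> (x, c 0) = (if x = c (l - 1) then \<zeta> ^ (l - 1) else 0)"
  using wave_to[of "l - 1"] l_ge closed by simp

section \<open>The difference of the two opposite waves as an eigenfunction\<close>

interpretation rev: cycle_enum G d l "\<lambda>i. c (l - i)"
  by (rule reverse)

definition cycle_function :: "complex \<Rightarrow> 'a \<times> 'a \<Rightarrow> complex" where
  "cycle_function \<zeta> e = wave \<zeta> e - rev.wave \<zeta> e"

lemma cycle_function_support: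
  assumes "cycle_function \<zeta> (x, y) \<noteq> 0"
  shows "(x, y) \<in> parcs G" "y \<in> c ` {..<l}"
proof -
  from assms consider "wave \<zeta> (x, y) \<noteq> 0" | "rev.wave \<zeta> (x, y) \<noteq> 0"
    by (cases "wave \<zeta> (x, y) = 0") (simp_all add: cycle_function_def)
  then have "(x, y) \<in> parcs G \<and> y \<in> c ` {..<l}"
  proof cases
    case 1
    then show ?thesis using wave_support[of \<zeta> x y] by simp
  next
    case 2
    have "(\<lambda>i. c (l - i)) ` {..<l} \<subseteq> c ` {..<l}" using c_mem by auto
    then show ?thesis using rev.wave_support[OF 2] by (auto)
  qed
  then show "(x, y) \<in> parcs G" "y \<in> c ` {..<l}" by simp_all
qed

text \<open>The reversed wave leaves \<open>c 0\<close> towards \<open>c (l - 1)\<close>, which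
  differs from \<open>c 1\<close>, so it contributes nothing here.\<close>

lemma cycle_function_first_arc: "cycle_function \<zeta> (c 0, c 1) = 1"
  using wave_from[of 0 \<zeta> "c 1"] rev.wave_from[of 0 \<zeta> "c 1"] c_eq_iff[of 1 "l - 1"] l_ge closed
  by (simp add: cycle_function_def)

lemma cycle_function_eigenspace:
  assumes deg: "\<forall>v \<in> pverts G. deg G v \<ge> 2" and \<zeta>: "\<zeta> ^ l * of_nat (d - 1) = 1"
  shows "cycle_function \<zeta> \<in> nb_eigenspace G (1 - \<zeta>)"
proof (rule mem_nb_eigenspaceI[OF graph deg])
  show "cycle_function \<zeta> \<in> edge_functions G"
    using cycle_function_support by (auto simp: edge_functions_def)
  fix x y assume xy: "(x, y) \<in> parcs G"
  show "(\<Sum>z | (y, z) \<in> parcs G \<and> z \<noteq> x. cycle_function \<zeta> (y, z)) =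
      \<zeta> * of_nat (deg G y - 1) * cycle_function \<zeta> (x, y)"
  proof (cases "y = c 0")
    case False
    then show ?thesis
      using wave_propagates[OF xy] rev.wave_propagates[OF xy] closed
      by (simp add: cycle_function_def sum_subtractf right_diff_distrib)
  next
    case True
    have "\<zeta> * \<zeta> ^ (l - 1) = \<zeta> ^ l" using l_ge by (simp flip: power_Suc)
    then have one: "\<zeta> * of_nat (d - 1) * \<zeta> ^ (l - 1) = 1" using \<zeta> by (metis mult.commute mult.assoc)
    have ne: "c 1 \<noteq> c (l - 1)" using c_eq_iff[of 1 "l - 1"] l_ge by simp
    \<comment> \<open>Each wave contributes 1 unless its own first arc backtracks. The constants
      cancel, leaving indicators of \<open>c (l - 1)\<close> and \<open>c 1\<close>, the inputs of
      the last arcs of the two waves.\<close>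
    have "(\<Sum>z | (y, z) \<in> parcs G \<and> z \<noteq> x. cycle_function \<zeta> (y, z)) =
        (if x = c 1 then 0 else 1) - (if x = c (l - 1) then 0 else 1)"
      using wave_start[of \<zeta> x] rev.wave_start[of \<zeta> x] closed True
      by (simp add: cycle_function_def sum_subtractf)
    also have "\<dots> = (\<zeta> * of_nat (d - 1) * \<zeta> ^ (l - 1)) *
        ((if x = c (l - 1) then 1 else 0) - (if x = c 1 then 1 else 0))"
      unfolding one using ne by simp
    also have "\<dots> = \<zeta> * of_nat (d - 1) *
        ((if x = c (l - 1) then \<zeta> ^ (l - 1) else 0) - (if x = c 1 then \<zeta> ^ (l - 1) else 0))"
      using ne by auto
    also have "\<dots> = \<zeta> * of_nat (deg G y - 1) * cycle_function \<zeta> (x, y)"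
      using wave_end[of \<zeta> x] rev.wave_end[of \<zeta> x] closed True deg_0 l_ge
      by (simp add: cycle_function_def)
    finally show ?thesis .
  qed
qed

end

section \<open>From cycles as subgraphs to enumerations\<close>

lemma pendant_cycle_enumeration:
  assumes "pair_graph G" and "d > 2" and "pendant_cycle G d l H"
  obtains c where "cycle_enum G d l c" and "pverts H = c ` {..<l}"
proof -
  from assms(3) obtain b v where l: "l \<ge> 3" and b: "inj_on b {..<l}" "pverts H = b ` {..<l}"
    and arcs: "parcs H = {(b i, b j) | i j. i < l \<and> j < l \<and> (j = Suc i mod l \<or> i = Suc j mod l)}"
    and sub: "parcs H = parcs G \<inter> (pverts H \<times> pverts H)"
    and v: "v \<in> pverts H" "deg G v = d" "\<forall>u \<in> pverts H - {v}. deg G u = 2"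
    unfolding pendant_cycle_def chordless_cycle_def by blast
  from v(1) b(2) obtain k where k: "k < l" "v = b k" by auto
  \<comment> \<open>The given enumeration is rotated so that the vertex of degree \<open>d\<close>
    gets index 0; reduction modulo \<open>l\<close> also yields \<open>c l = c 0\<close>.\<close>
  define c where "c i = b ((k + i) mod l)" for i
  have inj: "inj_on c {..<l}"
  proof (rule inj_onI)
    fix i j assume ij: "i \<in> {..<l}" "j \<in> {..<l}" "c i = c j"
    then have "(k + i) mod l = (k + j) mod l"
      using l by (intro inj_onD[OF b(1)]) (auto simp: c_def)
    then have "[k + i = k + j] (mod l)" by (simp add: cong_def)
    then have "[i = j] (mod l)" by (simp add: cong_add_lcancel_nat)
    then show "i = j" using ij by (simp add: cong_def)
  qed
  have verts: "pverts H = c ` {..<l}"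
  proof (rule card_subset_eq[symmetric])
    show "c ` {..<l} \<subseteq> pverts H" using b(2) l by (auto simp: c_def)
    show "card (c ` {..<l}) = card (pverts H)" using inj b by (simp add: card_image)
  qed (simp add: b(2))
  have c0: "c 0 = v" using k by (simp add: c_def)
  have "cycle_enum G d l c"
  proof (rule cycle_enum.intro)
    show "pair_graph G" "d > 2" "l \<ge> 3" "inj_on c {..<l}" by fact+
    show "c l = c 0" using k by (simp add: c_def)
    show "deg G (c 0) = d" using c0 v(2) by simp
    show "(c i, c (Suc i)) \<in> parcs G" if "i < l" for i
    proof -
      have "Suc ((k + i) mod l) mod l = (k + Suc i) mod l" by (simp add: mod_Suc_eq)
      moreover have "(k + i) mod l < l" "(k + Suc i) mod l < l" using l by auto
      ultimately have "(c i, c (Suc i)) \<in> parcs H"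
        unfolding arcs c_def by (intro CollectI exI[of _ "(k + i) mod l"] exI[of _ "(k + Suc i) mod l"] conjI disjI1) simp_all
      then show ?thesis using sub by auto
    qed
    show "deg G (c i) = 2" if "0 < i" "i < l" for i
    proof -
      have "c i \<noteq> c 0" using inj that by (auto dest: inj_onD)
      then show ?thesis using v(3) c0 verts that by auto
    qed
  qed
  then show thesis using verts that by blast
qed

text \<open>A chordless cycle is an induced subgraph, hence determined by its vertices.\<close>

lemma pendant_cycle_eqI:
  assumes "pendant_cycle G d l H" "pendant_cycle G d l H'" "pverts H = pverts H'"
  shows "H = H'"
proof -
  have "parcs H = parcs H'"
    using assms by (auto simp: pendant_cycle_def chordless_cycle_def)
  with assms(3) show ?thesis by (cases H; cases H') simp
qed

section \<open>Eigenvalues and multiplicities\<close>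

lemma pendant_cycle_eigenvalue:
  assumes G: "pair_graph G" and deg: "\<forall>v \<in> pverts G. deg G v \<ge> 2" and d: "d > 2"
    and \<zeta>: "\<zeta> ^ l * of_nat (d - 1) = 1"
  shows "(\<exists>H. pendant_cycle G d l H) \<longrightarrow> nb_eigenvalue G (1 - \<zeta>)"
    and "card {H. pendant_cycle G d l H} \<le> nb_geometric_multiplicity G (1 - \<zeta>)"
proof -
  have "\<forall>H \<in> {H. pendant_cycle G d l H}. \<exists>c. cycle_enum G d l c \<and> pverts H = c ` {..<l}"
    using pendant_cycle_enumeration[OF G d] by blast
  then obtain c where c: "\<And>H. pendant_cycle G d l H \<Longrightarrow> cycle_enum G d l (c H)"
    and verts: "\<And>H. pendant_cycle G d l H \<Longrightarrow> pverts H = c H ` {..<l}"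
    unfolding bchoice_iff by auto
  define f where "f H = cycle_enum.cycle_function l (c H) \<zeta>" for H
  define e where "e H = (c H 0, c H 1)" for H
  have mem: "f H \<in> nb_eigenspace G (1 - \<zeta>)" and diag: "f H (e H) \<noteq> 0" if "pendant_cycle G d l H" for H
    using cycle_enum.cycle_function_eigenspace[OF c[OF that] deg \<zeta>]
      cycle_enum.cycle_function_first_arc[OF c[OF that]]
    by (simp_all add: f_def e_def)
  \<comment> \<open>The first arc of each cycle serves as its test point: a nonzero value there
    would put the degree-2 vertex \<open>c H 1\<close> on \<open>H'\<close>, forcing the two cycles
    to coincide.\<close>
  have off: "f H' (e H) = 0"
    if H: "pendant_cycle G d l H" and H': "pendant_cycle G d l H'" and "H \<noteq> H'" for H H'
  proof (rule ccontr)
    assume "f H' (e H) \<noteq> 0"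
    then have "c H 1 \<in> c H' ` {..<l}"
      unfolding f_def e_def by (rule cycle_enum.cycle_function_support(2)[OF c[OF H']])
    then have "pverts H = pverts H'"
      using cycle_enum.vertices_eq[OF c[OF H] c[OF H']] verts H H' by simp
    then show False using pendant_cycle_eqI[OF H H'] \<open>H \<noteq> H'\<close> by simp
  qed
  show "(\<exists>H. pendant_cycle G d l H) \<longrightarrow> nb_eigenvalue G (1 - \<zeta>)"
    using mem diag unfolding nb_eigenvalue_def by (metis zero_fun_apply)
  show "card {H. pendant_cycle G d l H} \<le> nb_geometric_multiplicity G (1 - \<zeta>)"
    by (rule card_le_nb_geometric_multiplicity[OF G, where f = f and e = e])
      (use mem diag off in auto)
qed

theorem theorem5p5:
  fixes G :: "'a pair_pre_digraph" and d l :: nat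
  assumes "pair_graph G"
    and "\<forall>v \<in> pverts G. deg G v \<ge> 2"
    and "d > 2" and "l \<ge> 3"
  shows "((\<exists>H. pendant_cycle G d l H) \<longrightarrow>
            nb_eigenvalue G (complex_of_real (1 - 1 / root l (real d - 1))))
       \<and> ((\<exists>H. pendant_cycle G d l H \<and> even l) \<longrightarrow>
            nb_eigenvalue G (complex_of_real (1 + 1 / root l (real d - 1))))
       \<and> nb_geometric_multiplicity G (complex_of_real (1 - 1 / root l (real d - 1)))
            \<ge> card {H. pendant_cycle G d l H}
       \<and> nb_geometric_multiplicity G (complex_of_real (1 + 1 / root l (real d - 1)))
            \<ge> card {H. pendant_cycle G d l H \<and> even l}"
proof -
  let ?\<zeta> = "complex_of_real (1 / root l (real d - 1))"
  have "(1 / root l (real d - 1)) ^ l * real (d - 1) = 1"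
    using assms(3,4) by (simp add: power_divide)
  then have \<zeta>: "?\<zeta> ^ l * of_nat (d - 1) = 1"
    by (metis of_real_1 of_real_mult of_real_of_nat_eq of_real_power)
  note pos = pendant_cycle_eigenvalue[OF assms(1-3) \<zeta>]
  \<comment> \<open>For even \<open>l\<close> the sign disappears in the power, so
    \<open>- ?\<zeta>\<close> satisfies the same equation.\<close>
  have neg: "(\<exists>H. pendant_cycle G d l H) \<longrightarrow> nb_eigenvalue G (1 - (- ?\<zeta>))"
    "card {H. pendant_cycle G d l H} \<le> nb_geometric_multiplicity G (1 - (- ?\<zeta>))" if "even l"
    using pendant_cycle_eigenvalue[OF assms(1-3), where \<zeta> = "- ?\<zeta>" and l = l] \<zeta> that by simp_all
  have eqs: "complex_of_real (1 - 1 / root l (real d - 1)) = 1 - ?\<zeta>"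
    "complex_of_real (1 + 1 / root l (real d - 1)) = 1 - (- ?\<zeta>)" by simp_all
  \<comment> \<open>For odd \<open>l\<close> the claims about \<open>1 + ?\<zeta>\<close> are
    trivial: there are no even cycles, and the count is 0.\<close>
  show ?thesis
    unfolding eqs using pos neg by (cases "even l") auto
qed

end
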